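(* Let $G$ be a non-complete graph with order $n$. Then $\mathrm{gp}(\mathcal{M}(G))$ is the largest value of $n+n_1-n_4$ over all $\mathcal{MGP}$-partitions $(V_1,V_2,V_3,V_4)$ of $G$, where $n_i=|V_i|$ for $1\leq i\leq 4$.
   Context: All graphs are simple, connected and finite. $d_G$ is the graph distance. A set $S$ of vertices of a graph $H$ is a general position set if no shortest path in $H$ contains three or more vertices of $S$; $\mathrm{gp}(H)$ is the number of vertices in a largest general position set of $H$. The Mycielskian $\mathcal{M}(G)$ of a graph $G$ with vertex set $V$ and edge set $E$ has vertex set $V\cup V'\cup\{u^*\}$, where $V'=\{u' : u\in V\}$ is a disjoint copy of $V$ and $u^*$ is an additional vertex (the root), and edge set $E\cup\{uv' : uv\in E\}\cup\{v'u^* : v'\in V'\}$ (for each edge $uv\in E$ both $uv'$ and $vu'$ are included). A partition $\pi=(V_1,V_2,V_3,V_4)$ of $V(G)$ into four (possibly empty) sets is an $\mathcal{MGP}$-partition if and only if: (1) if $e$ is an edge in the subgraph induced by $V_1\cup V_3$, then $e$ has both endpoints in $V_3$; (2) if a vertex $u\in V_1\cup V_3$ has a neighbour $v\in V_2$, then $d_G(u,w)=2$ for all $w\in (V_1\cup V_2)\setminus\{u,v\}$ and $d_G(u,w)\leq 3$ for all $w\in V_3\setminus\{u\}$; (3) if $P$ is a shortest path $u_0,u_1,\dots,u_\ell$ of length $\ell\leq 4$ in $G$ with both endpoints in $V_1\cup V_2\cup V_3$ that passes through three or more vertices of $V_1\cup V_2\cup V_3$, then either $u_0,u_\ell\in V_2$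 and $\ell\geq 3$, or else $P$ or its reverse has one of the forms: (a) $u_0,u_1,u_2$ where $u_0,u_1\in V_2$; (b) $u_0,u_1,u_2,u_3$ where $u_0,u_1\in V_2$, $u_2\notin V_1\cup V_2\cup V_3$ and $u_3\in V_1\cup V_3$; (c) $u_0,u_1,u_2,u_3,u_4$ where $u_0\in V_2$, $u_3\notin V_1\cup V_2$ and $u_4\in V_1\cup V_3$. *)

theory Defs
  imports "Graph_Theory.Graph_Theory"
begin

text \<open>
  Finite simple graphs are represented as pairs \<open>G\<close> with \<^term>\<open>pair_graph G\<close>: finite, loopfree,
  symmetric, with arcs being ordered pairs of vertices, so each edge \<open>uv\<close> is present as both
  \<open>(u, v)\<close> and \<open>(v, u)\<close>. Paths are lists of vertices.
\<close>

text \<open>Graph distance: the library's shortest-path cost with unit weights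
  (\<open>\<infinity>\<close> between different components).\<close>

definition gdist :: "('a, 'b) pre_digraph \<Rightarrow> 'a \<Rightarrow> 'a \<Rightarrow> ereal" where
  "gdist G u v = wf_digraph.\<mu> G (\<lambda>_. 1) u v"

definition shortest_vpath :: "('a, 'b) pre_digraph \<Rightarrow> 'a list \<Rightarrow> bool" where
  "shortest_vpath G p \<longleftrightarrow> vpath p G \<and> ereal (real (vwalk_length p)) = gdist G (hd p) (last p)"

definition general_position_set :: "('a, 'b) pre_digraph \<Rightarrow> 'a set \<Rightarrow> bool" where
  "general_position_set G S \<longleftrightarrow>
     S \<subseteq> verts G \<and> \<not> (\<exists>p. shortest_vpath G p \<and> card (set p \<inter> S) \<ge> 3)"

definition gp_number :: "('a, 'b) pre_digraph \<Rightarrow> nat" where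
  "gp_number G = Max {card S | S. general_position_set G S}"

datatype 'a myc_vertex = Orig 'a | Copy 'a | Root

definition mycielskian :: "'a pair_pre_digraph \<Rightarrow> 'a myc_vertex pair_pre_digraph" where
  "mycielskian G =
     \<lparr> pverts = Orig ` pverts G \<union> Copy ` pverts G \<union> {Root},
       parcs = {(Orig u, Orig v) | u v. (u, v) \<in> parcs G}
             \<union> {(Orig u, Copy v) | u v. (u, v) \<in> parcs G}
             \<union> {(Copy u, Orig v) | u v. (u, v) \<in> parcs G}
             \<union> {(Copy v, Root) | v. v \<in> pverts G}
             \<union> {(Root, Copy v) | v. v \<in> pverts G} \<rparr>"

text \<open>Admissible shapes, read in one direction, of a short shortest path \<open>p\<close> with both ends in
  \<open>V1 \<union> V2 \<union> V3\<close> that meets this union in three or more vertices.\<close>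

definition mgp_path_form :: "'a set \<Rightarrow> 'a set \<Rightarrow> 'a set \<Rightarrow> 'a list \<Rightarrow> bool" where
  "mgp_path_form V1 V2 V3 p \<longleftrightarrow>
     (\<exists>u0 u1 u2. p = [u0, u1, u2] \<and> u0 \<in> V2 \<and> u1 \<in> V2) \<or>
     (\<exists>u0 u1 u2 u3. p = [u0, u1, u2, u3] \<and> u0 \<in> V2 \<and> u1 \<in> V2 \<and>
        u2 \<notin> V1 \<union> V2 \<union> V3 \<and> u3 \<in> V1 \<union> V3) \<or>
     (\<exists>u0 u1 u2 u3 u4. p = [u0, u1, u2, u3, u4] \<and> u0 \<in> V2 \<and>
        u3 \<notin> V1 \<union> V2 \<and> u4 \<in> V1 \<union> V3)"

definition mgp_partition ::
    "'a pair_pre_digraph \<Rightarrow> 'a set \<Rightarrow> 'a set \<Rightarrow> 'a set \<Rightarrow> 'a set \<Rightarrow> bool" where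
  "mgp_partition G V1 V2 V3 V4 \<longleftrightarrow>
     V1 \<union> V2 \<union> V3 \<union> V4 = pverts G \<and>
     V1 \<inter> V2 = {} \<and> V1 \<inter> V3 = {} \<and> V1 \<inter> V4 = {} \<and>
     V2 \<inter> V3 = {} \<and> V2 \<inter> V4 = {} \<and> V3 \<inter> V4 = {} \<and>
     (\<forall>u v. (u, v) \<in> parcs G \<and> u \<in> V1 \<union> V3 \<and> v \<in> V1 \<union> V3 \<longrightarrow> u \<in> V3 \<and> v \<in> V3) \<and>
     (\<forall>u v. u \<in> V1 \<union> V3 \<and> v \<in> V2 \<and> (u, v) \<in> parcs G \<longrightarrow>
        (\<forall>w \<in> (V1 \<union> V2) - {u, v}. gdist G u w = 2) \<and>
        (\<forall>w \<in> V3 - {u}. gdist G u w \<le> 3)) \<and>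
     (\<forall>p. shortest_vpath G p \<and> vwalk_length p \<le> 4 \<and>
          hd p \<in> V1 \<union> V2 \<union> V3 \<and> last p \<in> V1 \<union> V2 \<union> V3 \<and>
          card (set p \<inter> (V1 \<union> V2 \<union> V3)) \<ge> 3 \<longrightarrow>
        (hd p \<in> V2 \<and> last p \<in> V2 \<and> vwalk_length p \<ge> 3) \<or>
        mgp_path_form V1 V2 V3 p \<or> mgp_path_form V1 V2 V3 (rev p))"

text \<open>Between vertices of the same component, \<^const>\<open>gdist\<close> is the least length of a walk, given as a list of vertices.\<close>

lemma (in wf_digraph) awalk_cost_unit: "awalk_cost (\<lambda>_. 1) es = real (length es)"
  by (induction es) auto

lemma (in wf_digraph) vwalk_imp_awalk:
  assumes "vwalk p G"
  shows "\<exists>es. awalk (hd p) es (last p) \<and> length es = vwalk_length p"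
  using assms
proof (induction p rule: list.induct)
  case Nil
  then show ?case by (simp add: vwalk_def)
next
  case (Cons x p)
  show ?case
  proof (cases "p = []")
    case True
    with Cons.prems have "awalk x [] x" by (simp add: vwalk_def awalk_Nil_iff)
    with True show ?thesis by (intro exI[of _ "[]"]) simp
  next
    case False
    from Cons.prems False have arc: "(x, hd p) \<in> arcs_ends G" and "vwalk p G"
      by (auto simp: vwalk_def)
    with Cons.IH obtain es where es: "awalk (hd p) es (last p)" "length es = vwalk_length p"
      by auto
    from arc obtain e where e: "e \<in> arcs G" "tail G e = x" "head G e = hd p"
      by (auto simp: arcs_ends_conv)
    with es have "awalk x (e # es) (last p)" by (simp add: awalk_Cons_iff)
    moreover have "length p > 0" using False by simp
    ultimately show ?thesis using es False by (intro exI[of _ "e # es"]) simp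
  qed
qed

lemma (in wf_digraph) awalk_imp_vwalk_length:
  assumes "awalk u es v"
  shows "\<exists>p. vwalk p G \<and> hd p = u \<and> last p = v \<and> vwalk_length p = length es"
  using assms
proof (induction es arbitrary: u)
  case Nil
  then show ?case by (intro exI[of _ "[u]"]) (auto simp: awalk_Nil_iff vwalk_def)
next
  case (Cons e es)
  then have e: "e \<in> arcs G" "tail G e = u" and "awalk (head G e) es v"
    by (auto simp: awalk_Cons_iff)
  with Cons.IH obtain p where p: "vwalk p G" "hd p = head G e" "last p = v"
      "vwalk_length p = length es" by blast
  then have "p \<noteq> []" by (auto simp: vwalk_def)
  have "(u, hd p) \<in> arcs_ends G" using e p by (auto simp: arcs_ends_conv)
  moreover have "u \<in> verts G" using e by auto
  ultimately have "vwalk (u # p) G" using p by (intro vwalk_consI)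
  with \<open>p \<noteq> []\<close> p show ?case by (intro exI[of _ "u # p"]) (cases p, auto)
qed

lemma (in wf_digraph) gdist_le_vwalk_length:
  assumes "vwalk p G"
  shows "gdist G (hd p) (last p) \<le> ereal (real (vwalk_length p))"
proof -
  from vwalk_imp_awalk[OF assms] obtain es
    where "awalk (hd p) es (last p)" "length es = vwalk_length p" by blast
  with min_cost_le_walk_cost[of "hd p" es "last p" "\<lambda>_. 1"] show ?thesis
    by (simp add: gdist_def awalk_cost_unit)
qed

lemma (in fin_digraph) gdist_attained:
  assumes "u \<rightarrow>\<^sup>* v"
  shows "\<exists>p. vwalk p G \<and> hd p = u \<and> last p = v \<and> gdist G u v = ereal (real (vwalk_length p))"
proof -
  obtain es where "apath u es v" "\<mu> (\<lambda>_. 1) u v = ereal (awalk_cost (\<lambda>_. 1) es)"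
    using min_cost_awalk[OF assms, of "\<lambda>_. 1"] by auto
  with awalk_imp_vwalk_length[of u es v] show ?thesis
    by (auto simp: gdist_def awalk_cost_unit apath_def)
qed

lemma (in pair_graph) pair_graph_mycielskian: "pair_graph (mycielskian G)"
proof
  let ?M = "mycielskian G"
  show "fst e \<in> pverts ?M" "snd e \<in> pverts ?M" if "e \<in> parcs ?M" for e
    using that by (auto simp: mycielskian_def dest: in_arcsD1 in_arcsD2)
  show fin: "finite (pverts ?M)"
    by (simp add: mycielskian_def pair_finite_verts)
  have "parcs ?M \<subseteq> pverts ?M \<times> pverts ?M"
    by (auto simp: mycielskian_def dest: in_arcsD1 in_arcsD2)
  with fin show "finite (parcs ?M)" by (meson finite_SigmaI finite_subset)
  show "fst e \<noteq> snd e" if "e \<in> parcs ?M" for e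
    using that pair_no_loops by (fastforce simp: mycielskian_def)
  show "symmetric ?M"
    using pair_sym_arcs by (auto simp: mycielskian_def symmetric_def sym_def)
qed

end

theory Submission
  imports Defs
begin

text \<open>
  A set of vertices of the Mycielskian \<open>M\<close> of \<open>G\<close> that avoids the root amounts to a partition of the
  vertices of \<open>G\<close>: \<open>V1\<close> collects the vertices \<open>u\<close> for which both \<open>u\<close> and its copy \<open>u'\<close> are chosen,
  \<open>V2\<close> those for which only \<open>u'\<close> is, \<open>V3\<close> those for which only \<open>u\<close> is, and \<open>V4\<close> those for which
  neither is. The set has \<open>2 n1 + n2 + n3 = n + n1 - n4\<close> members. So the theorem says two things: such a
  set is in general position exactly when the partition is an MGP-partition
  (\<open>general_position_of_mgp\<close>, \<open>mgp_of_general_position\<close>), and the root does not help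
  (\<open>root_free_alternative\<close>).

  General position is a metric property: no member is between two others, that is, no distinct
  members satisfy \<open>\<delta> x z = \<delta> x y + \<delta> y z\<close> (\<open>general_position_set_iff\<close>). The distances of \<open>M\<close> are
  truncations of those of \<open>G\<close>: for \<open>u \<noteq> v\<close> they are \<open>min (\<delta> u v) 4\<close> for \<open>u\<close> and \<open>v\<close>,
  \<open>min (\<delta> u v) 3\<close> for \<open>u\<close> and \<open>v'\<close>, and \<open>2\<close> for \<open>u'\<close> and \<open>v'\<close>, while \<open>u\<close> and \<open>u'\<close> are at distance 2.
  The upper limits come from the detour through the root. With these formulas the first claim is a case
  distinction on three members, each an original vertex or a copy, and the MGP conditions turn out to
  be what excludes betweenness in every case. As no
  distance exceeds 4, only paths of length at most 4 matter.

  A set in general position that contains the root has at most \<open>n + 1\<close> members. Up to \<open>n\<close>, it is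
  matched by the set of all copies. It has \<open>n + 1\<close> members only if \<open>G\<close> has a leaf
  \<open>v\<close> whose neighbour is adjacent to all other vertices, and then \<open>v\<close> with all copies is a root-free set
  in general position of that size. Non-completeness enters here: it keeps a set in general position from
  containing all original vertices.
\<close>

section \<open>Distances and general position\<close>

text \<open>Within one component this is the extended-real distance \<^const>\<open>gdist\<close>, but as a
  natural number, so that sums and truncations of distances are linear arithmetic; between
  components it has no meaning.\<close>
definition hop_dist :: "'a pair_pre_digraph \<Rightarrow> 'a \<Rightarrow> 'a \<Rightarrow> nat" where
  "hop_dist G u v = (LEAST k. (u, v) \<in> parcs G ^^ k)"

lemma list_of_small_length:
  "length p = 3 \<Longrightarrow> p = [p ! 0, p ! 1, p ! 2]"
  "length p = 4 \<Longrightarrow> p = [p ! 0, p ! 1, p ! 2, p ! 3]"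
  "length p = 5 \<Longrightarrow> p = [p ! 0, p ! 1, p ! 2, p ! 3, p ! 4]"
  by (auto simp: list_eq_iff_nth_eq nth_Cons' less_Suc_eq numeral_eq_Suc)

lemma vwalk_step:
  assumes "vwalk p G" "Suc i < length p"
  shows "(p ! i, p ! Suc i) \<in> arcs_ends G"
proof -
  have "set (vwalk_arcs p) \<subseteq> R \<Longrightarrow> Suc i < length p \<Longrightarrow> (p ! i, p ! Suc i) \<in> R" for R i and p :: "'a list"
    by (induction p arbitrary: i rule: vwalk_arcs.induct) (auto simp: nth_Cons split: nat.splits)
  with assms show ?thesis by auto
qed

lemma vwalk_relpow:
  assumes "vwalk p G" "i \<le> j" "j < length p"
  shows "(p ! i, p ! j) \<in> arcs_ends G ^^ (j - i)"
  using assms(2,3)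
proof (induction j rule: dec_induct)
  case (step j)
  with vwalk_step[OF assms(1), of j] show ?case
    by (auto simp: Suc_diff_le intro: relpow_Suc_I)
qed simp

locale connected_pair_graph = pair_graph +
  assumes linked: "u \<in> pverts G \<Longrightarrow> v \<in> pverts G \<Longrightarrow> (u, v) \<in> (parcs G)\<^sup>*"
begin

abbreviation \<delta> :: "'a \<Rightarrow> 'a \<Rightarrow> nat" where
  "\<delta> \<equiv> hop_dist G"

lemma dist_le: "(u, v) \<in> parcs G ^^ k \<Longrightarrow> \<delta> u v \<le> k"
  unfolding hop_dist_def by (rule Least_le)

lemma dist_attained:
  assumes "u \<in> pverts G" "v \<in> pverts G"
  shows "(u, v) \<in> parcs G ^^ \<delta> u v"
proof -
  obtain k where "(u, v) \<in> parcs G ^^ k"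
    using linked[OF assms] rtrancl_imp_relpow by metis
  then show ?thesis unfolding hop_dist_def by (rule LeastI)
qed

lemma dist_self [simp]: "\<delta> u u = 0"
  using dist_le[of u u 0] by simp

lemma dist_eq_0_iff [simp]:
  "u \<in> pverts G \<Longrightarrow> v \<in> pverts G \<Longrightarrow> \<delta> u v = 0 \<longleftrightarrow> u = v"
  using dist_attained[of u v] by auto

lemma dist_eq_1_iff:
  assumes "u \<in> pverts G" "v \<in> pverts G"
  shows "\<delta> u v = 1 \<longleftrightarrow> (u, v) \<in> parcs G"
proof
  assume "\<delta> u v = 1"
  then show "(u, v) \<in> parcs G" using dist_attained[OF assms] by simp
next
  assume arc: "(u, v) \<in> parcs G"
  then have "\<delta> u v \<le> 1" using dist_le[of u v 1] by simp
  moreover have "u \<noteq> v" using arc pair_no_loops[of "(u, v)"] by auto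
  ultimately show "\<delta> u v = 1" using dist_eq_0_iff[OF assms] by linarith
qed

lemma dist_triangle:
  assumes "u \<in> pverts G" "v \<in> pverts G" "w \<in> pverts G"
  shows "\<delta> u w \<le> \<delta> u v + \<delta> v w"
  using dist_attained[of u v] dist_attained[of v w] assms
  by (auto intro!: dist_le simp: relpow_add)

lemma arcs_commute: "(u, v) \<in> parcs G \<longleftrightarrow> (v, u) \<in> parcs G"
  using pair_sym_arcs by (auto simp: symmetric_def elim: symE)

lemma dist_commute: "\<delta> u v = \<delta> v u"
proof -
  have "(u, v) \<in> parcs G ^^ k \<Longrightarrow> (v, u) \<in> parcs G ^^ k" for k u v
    by (induction k arbitrary: v) (auto simp: arcs_commute simp del: relpow.simps(2) intro: relpow_Suc_I2 elim!: relpow_Suc_E)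
  then have "(u, v) \<in> parcs G ^^ k \<longleftrightarrow> (v, u) \<in> parcs G ^^ k" for k
    by blast
  then show ?thesis by (simp add: hop_dist_def)
qed

lemma ex_vwalk_of_relpow:
  "(u, v) \<in> parcs G ^^ k \<Longrightarrow> u \<in> pverts G \<Longrightarrow>
    \<exists>p. vwalk p G \<and> hd p = u \<and> last p = v \<and> length p = Suc k"
proof (induction k arbitrary: u)
  case 0
  then show ?case by (intro exI[of _ "[u]"]) auto
next
  case (Suc k)
  then obtain x where x: "(u, x) \<in> parcs G" "(x, v) \<in> parcs G ^^ k"
    by (meson relpow_Suc_D2)
  then obtain p where p: "vwalk p G" "hd p = x" "last p = v" "length p = Suc k"
    using Suc.IH in_arcsD2 by blast
  have "vwalk (u # p) G" using p x Suc.prems by (intro vwalk_consI) auto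
  moreover have "p \<noteq> []" using p by auto
  ultimately show ?case using p by (intro exI[of _ "u # p"]) auto
qed

lemma gdist_eq_dist:
  assumes "u \<in> pverts G" "v \<in> pverts G"
  shows "gdist G u v = ereal (real (\<delta> u v))"
proof -
  obtain p where p: "vwalk p G" "hd p = u" "last p = v" "length p = Suc (\<delta> u v)"
    using ex_vwalk_of_relpow[OF dist_attained[OF assms] assms(1)] by blast
  from vwalk_imp_awalk[OF p(1)] p have "u \<rightarrow>\<^sup>*\<^bsub>G\<^esub> v"
    by (auto simp: reachable_awalk)
  then obtain q where q: "vwalk q G" "hd q = u" "last q = v"
      "gdist G u v = ereal (real (vwalk_length q))"
    using gdist_attained by blast
  then have "q \<noteq> []" by auto
  then have "\<delta> u v \<le> vwalk_length q"
    using vwalk_relpow[OF q(1), of 0 "length q - 1"] q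
    by (auto simp: hd_conv_nth last_conv_nth intro: dist_le)
  moreover have "gdist G u v \<le> ereal (real (\<delta> u v))"
    using gdist_le_vwalk_length[OF p(1)] p by simp
  ultimately show ?thesis using q(4) by simp
qed

lemma gdist_numeral_iff:
  assumes "u \<in> pverts G" "v \<in> pverts G"
  shows "gdist G u v = numeral k \<longleftrightarrow> \<delta> u v = numeral k"
    and "gdist G u v \<le> numeral k \<longleftrightarrow> \<delta> u v \<le> numeral k"
proof -
  have "(numeral k :: ereal) = ereal (real (numeral k))" by simp
  then show "gdist G u v = numeral k \<longleftrightarrow> \<delta> u v = numeral k"
    and "gdist G u v \<le> numeral k \<longleftrightarrow> \<delta> u v \<le> numeral k"
    unfolding gdist_eq_dist[OF assms] by (simp_all only: ereal.inject ereal_less_eq of_nat_eq_iff of_nat_le_iff)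
qed

text \<open>A walk gives \<open>\<delta> (p ! i) (p ! j) \<le> j - i\<close> for all positions. If one of these inequalities
  were strict, the triangle inequality would make the distance of the ends smaller than the
  length.\<close>

lemma dist_nth_of_geodesic:
  assumes "vwalk p G" "\<delta> (hd p) (last p) = length p - 1" "i \<le> j" "j < length p"
  shows "\<delta> (p ! i) (p ! j) = j - i"
proof -
  have step: "\<delta> (p ! a) (p ! b) \<le> b - a" if "a \<le> b" "b < length p" for a b
    using vwalk_relpow[OF assms(1) that] by (auto intro: dist_le)
  have "p \<noteq> []" using assms by auto
  have v: "p ! a \<in> pverts G" if "a < length p" for a
    using assms(1) nth_mem[OF that] by (auto simp: vwalk_def)
  have "length p - 1 = \<delta> (p ! 0) (p ! (length p - 1))"
    using assms(2) \<open>p \<noteq> []\<close> by (simp add: hd_conv_nth last_conv_nth)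
  also have "\<dots> \<le> \<delta> (p ! 0) (p ! i) + (\<delta> (p ! i) (p ! j) + \<delta> (p ! j) (p ! (length p - 1)))"
    using dist_triangle[of "p ! 0" "p ! i" "p ! (length p - 1)"]
      dist_triangle[of "p ! i" "p ! j" "p ! (length p - 1)"] v assms(3,4) by fastforce
  also have "\<dots> \<le> i + (\<delta> (p ! i) (p ! j) + (length p - 1 - j))"
    using step[of 0 i] step[of j "length p - 1"] assms(3,4) by (intro add_mono) auto
  finally have "j - i \<le> \<delta> (p ! i) (p ! j)" using assms(3,4) by linarith
  with step[OF assms(3,4)] show ?thesis by simp
qed

text \<open>Distinctness is automatic: positions \<open>i < j\<close> carry vertices at distance \<open>j - i > 0\<close>.\<close>
lemma shortest_vpath_iff:
  "shortest_vpath G p \<longleftrightarrow> vwalk p G \<and> \<delta> (hd p) (last p) = length p - 1"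
proof -
  have "gdist G (hd p) (last p) = ereal (real (\<delta> (hd p) (last p)))" if "vwalk p G"
    using that by (intro gdist_eq_dist) (auto simp: vwalk_def)
  moreover have "distinct p" if p: "vwalk p G" "\<delta> (hd p) (last p) = length p - 1"
  proof -
    have "p ! i \<noteq> p ! j" if "i < j" "j < length p" for i j
      using dist_nth_of_geodesic[OF p, of i j] that by auto
    then show ?thesis unfolding distinct_conv_nth by (metis linorder_neqE_nat)
  qed
  ultimately show ?thesis
    by (auto simp: shortest_vpath_def vpath_def)
qed

lemma ex_shortest_vpath_through:
  assumes "x \<in> pverts G" "y \<in> pverts G" "z \<in> pverts G"
    and "\<delta> x z = \<delta> x y + \<delta> y z"
  shows "\<exists>p. shortest_vpath G p \<and> hd p = x \<and> last p = z \<and> length p = Suc (\<delta> x z)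
    \<and> p ! \<delta> x y = y"
proof -
  obtain p where p: "vwalk p G" "hd p = x" "last p = y" "length p = Suc (\<delta> x y)"
    using ex_vwalk_of_relpow[OF dist_attained] assms by metis
  obtain q where q: "vwalk q G" "hd q = y" "last q = z" "length q = Suc (\<delta> y z)"
    using ex_vwalk_of_relpow[OF dist_attained] assms by metis
  have j: "joinable p q" using p q by (auto simp: joinable_def)
  have w: "vwalk (p \<oplus> q) G" using p(1) q(1) j by (rule vwalk_joinI_vwalk)
  have l: "length (p \<oplus> q) = Suc (\<delta> x z)" using p q assms(4) by (simp add: vwalk_join_def)
  have ends: "hd (p \<oplus> q) = x" "last (p \<oplus> q) = z" using j p q
    by (auto simp: vwalk_join_hd vwalk_join_last)
  have "p \<noteq> []" using p by auto
  then have "(p \<oplus> q) ! \<delta> x y = y" using p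
    by (auto simp: vwalk_join_def nth_append last_conv_nth)
  with w l ends show ?thesis by (auto simp: shortest_vpath_iff)
qed

text \<open>Three vertices on a shortest path satisfy \<open>\<delta> x z = \<delta> x y + \<delta> y z\<close> in their order along the
  path, and conversely shortest paths from \<open>x\<close> to \<open>y\<close> and from \<open>y\<close> to \<open>z\<close> then join to a shortest
  path. So general position depends on the distances of the members only, and the paths of the
  Mycielskian need never be classified.\<close>

lemma general_position_set_iff:
  "general_position_set G S \<longleftrightarrow> S \<subseteq> pverts G \<and>
    (\<forall>x\<in>S. \<forall>y\<in>S. \<forall>z\<in>S. x \<noteq> y \<longrightarrow> y \<noteq> z \<longrightarrow> \<delta> x z \<noteq> \<delta> x y + \<delta> y z)"
  (is "_ \<longleftrightarrow> _ \<and> ?free")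
proof (cases "S \<subseteq> pverts G")
  case True
  have "(\<exists>p. shortest_vpath G p \<and> card (set p \<inter> S) \<ge> 3) \<longleftrightarrow> \<not> ?free"
  proof
    assume "\<exists>p. shortest_vpath G p \<and> card (set p \<inter> S) \<ge> 3"
    then obtain p where p: "vwalk p G" "\<delta> (hd p) (last p) = length p - 1"
      and c: "card (set p \<inter> S) \<ge> 3"
      by (auto simp: shortest_vpath_iff)
    define I where "I = {i. i < length p \<and> p ! i \<in> S}"
    have "set p \<inter> S = (\<lambda>i. p ! i) ` I" by (auto simp: I_def in_set_conv_nth)
    moreover have "finite I" by (simp add: I_def)
    ultimately have "3 \<le> card I" using c card_image_le le_trans by metis
    then obtain i j k where ijk: "i \<in> I" "j \<in> I" "k \<in> I" "i < j" "j < k"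
    proof -
      obtain J where J: "J \<subseteq> I" "card J = 3" using \<open>3 \<le> card I\<close> by (meson obtain_subset_with_card_n)
      then obtain a b c where "J = {a, b, c}" "a \<noteq> b" "b \<noteq> c" "a \<noteq> c"
        by (auto simp: card_3_iff)
      with J show ?thesis using that by (smt (verit) insert_subset linorder_neqE_nat)
    qed
    have "\<delta> (p ! i) (p ! k) = \<delta> (p ! i) (p ! j) + \<delta> (p ! j) (p ! k)"
      "\<delta> (p ! i) (p ! j) \<noteq> 0" "\<delta> (p ! j) (p ! k) \<noteq> 0"
      using dist_nth_of_geodesic[OF p] ijk by (auto simp: I_def)
    then show "\<not> ?free" using ijk unfolding I_def by (metis (lifting) dist_self mem_Collect_eq)
  next
    assume "\<not> ?free"
    then obtain x y z where xyz: "x \<in> S" "y \<in> S" "z \<in> S" "x \<noteq> y" "y \<noteq> z"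
      "\<delta> x z = \<delta> x y + \<delta> y z" by blast
    then have v: "x \<in> pverts G" "y \<in> pverts G" "z \<in> pverts G" using True by auto
    with xyz have "x \<noteq> z" by auto
    obtain p where p: "shortest_vpath G p" "hd p = x" "last p = z"
      "length p = Suc (\<delta> x z)" "p ! \<delta> x y = y"
      using ex_shortest_vpath_through[OF v xyz(6)] by blast
    have "y \<in> set p" using p xyz(6) nth_mem[of "\<delta> x y" p] by simp
    moreover have "p \<noteq> []" using p by auto
    ultimately have "{x, y, z} \<subseteq> set p \<inter> S" using p xyz by auto
    then have "card {x, y, z} \<le> card (set p \<inter> S)" by (intro card_mono) auto
    then have "3 \<le> card (set p \<inter> S)" using xyz \<open>x \<noteq> z\<close> by simp
    with p show "\<exists>p. shortest_vpath G p \<and> card (set p \<inter> S) \<ge> 3" by blast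
  qed
  moreover have "general_position_set G S \<longleftrightarrow> \<not> (\<exists>p. shortest_vpath G p \<and> card (set p \<inter> S) \<ge> 3)"
    using True by (simp add: general_position_set_def)
  ultimately show ?thesis using True by blast
qed (simp add: general_position_set_def)

end

section \<open>Distances in the Mycielskian\<close>

primrec base_vertex :: "'a myc_vertex \<Rightarrow> 'a" where
  "base_vertex (Orig u) = u"
| "base_vertex (Copy u) = u"

primrec height :: "'a myc_vertex \<Rightarrow> nat" where
  "height (Orig u) = 2"
| "height (Copy u) = 1"
| "height Root = 0"

lemma in_pverts_mycielskian [simp]:
  "Orig u \<in> pverts (mycielskian G) \<longleftrightarrow> u \<in> pverts G"
  "Copy u \<in> pverts (mycielskian G) \<longleftrightarrow> u \<in> pverts G"
  "Root \<in> pverts (mycielskian G)"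
  by (auto simp: mycielskian_def)

lemma in_parcs_mycielskian [simp]:
  "(Orig u, Orig v) \<in> parcs (mycielskian G) \<longleftrightarrow> (u, v) \<in> parcs G"
  "(Orig u, Copy v) \<in> parcs (mycielskian G) \<longleftrightarrow> (u, v) \<in> parcs G"
  "(Copy u, Orig v) \<in> parcs (mycielskian G) \<longleftrightarrow> (u, v) \<in> parcs G"
  "(Copy u, Copy v) \<notin> parcs (mycielskian G)"
  "(Copy u, Root) \<in> parcs (mycielskian G) \<longleftrightarrow> u \<in> pverts G"
  "(Root, Copy u) \<in> parcs (mycielskian G) \<longleftrightarrow> u \<in> pverts G"
  "(Orig u, Root) \<notin> parcs (mycielskian G)"
  "(Root, Orig u) \<notin> parcs (mycielskian G)"
  "(Root, Root) \<notin> parcs (mycielskian G)"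
  by (auto simp: mycielskian_def)

text \<open>If every vertex of \<open>G\<close> has a neighbour, the height of a vertex is its distance from the
  root. A walk that meets the root is at least as long as the two heights together; a walk that avoids
  it projects to a walk of \<open>G\<close> of the same length. This is the lower bound behind the truncated
  distances below.\<close>
lemma mycielskian_walk:
  "(x, y) \<in> parcs (mycielskian G) ^^ k \<Longrightarrow>
    height x + height y \<le> k \<or>
    x \<noteq> Root \<and> y \<noteq> Root \<and> (base_vertex x, base_vertex y) \<in> parcs G ^^ k"
proof (induction k arbitrary: y)
  case 0
  then show ?case by (cases x) auto
next
  case (Suc k)
  then obtain z where z: "(x, z) \<in> parcs (mycielskian G) ^^ k" "(z, y) \<in> parcs (mycielskian G)"
    by auto
  have "height y \<le> Suc (height z)" using z(2) by (cases y; cases z) auto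
  moreover have "height x \<le> Suc k" if "y = Root"
  proof (cases k)
    case 0
    then have "x = z" using z by simp
    with z that 0 show ?thesis by (cases x) auto
  qed (cases x; simp)
  moreover have "(base_vertex z, base_vertex y) \<in> parcs G" if "z \<noteq> Root" "y \<noteq> Root"
    using that z(2) by (cases y; cases z) auto
  ultimately show ?case using Suc.IH[OF z(1)] by (cases "y = Root") (auto intro: relpow_Suc_I)
qed

lemma relpow_Orig_Orig:
  "(u, v) \<in> parcs G ^^ k \<Longrightarrow> (Orig u, Orig v) \<in> parcs (mycielskian G) ^^ k"
proof (induction k arbitrary: v)
  case (Suc k)
  then show ?case by (meson in_parcs_mycielskian(1) relpow_Suc_E relpow_Suc_I)
qed simp

lemma relpow_Orig_Copy:
  "(u, v) \<in> parcs G ^^ k \<Longrightarrow> k \<noteq> 0 \<Longrightarrow> (Orig u, Copy v) \<in> parcs (mycielskian G) ^^ k"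
  using relpow_Orig_Orig by (cases k) (fastforce elim!: relpow_Suc_E intro: relpow_Suc_I simp del: relpow.simps)+

text \<open>A second vertex gives every vertex a neighbour, without which the root of the Mycielskian
  would be cut off from the original vertices.\<close>
locale nontrivial_connected_graph = connected_pair_graph +
  assumes two_vertices: "\<exists>u\<in>pverts G. \<exists>v\<in>pverts G. u \<noteq> v"
begin

lemma ex_neighbour:
  assumes "u \<in> pverts G"
  shows "\<exists>v. (u, v) \<in> parcs G"
proof -
  obtain v where "v \<in> pverts G" "u \<noteq> v" using two_vertices by metis
  then show ?thesis using linked[OF assms] by (meson converse_rtranclE)
qed

lemma mycielskian_connected: "connected_pair_graph (mycielskian G)"
proof -
  interpret M: pair_graph "mycielskian G" by (rule pair_graph_mycielskian)
  have to_root: "(x, Root) \<in> (parcs (mycielskian G))\<^sup>*" if x: "x \<in> pverts (mycielskian G)" for x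
  proof (cases x)
    case (Orig u)
    with x obtain v where "(u, v) \<in> parcs G" using ex_neighbour by auto
    then have "(x, Copy v) \<in> parcs (mycielskian G)" "(Copy v, Root) \<in> parcs (mycielskian G)"
      using Orig in_arcsD2 by auto
    then show ?thesis by (meson r_into_rtrancl rtrancl_into_rtrancl)
  qed (use x in auto)
  have "sym (parcs (mycielskian G))" using M.pair_sym_arcs by (simp add: symmetric_def)
  then have "sym ((parcs (mycielskian G))\<^sup>*)" by (rule sym_rtrancl)
  then show ?thesis using to_root by unfold_locales (meson rtrancl_trans symD)
qed

sublocale M: connected_pair_graph "mycielskian G"
  by (rule mycielskian_connected)

lemma dist_Copy_Root [simp]: "u \<in> pverts G \<Longrightarrow> M.\<delta> (Copy u) Root = 1"
  by (subst M.dist_eq_1_iff) auto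

lemma dist_Orig_Root [simp]:
  assumes "u \<in> pverts G"
  shows "M.\<delta> (Orig u) Root = 2"
proof -
  obtain v where v: "(u, v) \<in> parcs G" using ex_neighbour[OF assms] by blast
  then have "v \<in> pverts G" using in_arcsD2 by auto
  then have "M.\<delta> (Orig u) (Copy v) = 1" by (subst M.dist_eq_1_iff) (use v assms in auto)
  then have "M.\<delta> (Orig u) Root \<le> 2"
    using M.dist_triangle[of "Orig u" "Copy v" Root] \<open>v \<in> pverts G\<close> assms by simp
  moreover have "M.\<delta> (Orig u) Root \<noteq> 0" "M.\<delta> (Orig u) Root \<noteq> 1"
    using M.dist_eq_1_iff[of "Orig u" Root] assms by auto
  ultimately show ?thesis by linarith
qed

lemma dist_ge:
  assumes "x \<in> pverts (mycielskian G)" "y \<in> pverts (mycielskian G)" "x \<noteq> Root" "y \<noteq> Root"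
  shows "min (\<delta> (base_vertex x) (base_vertex y)) (height x + height y) \<le> M.\<delta> x y"
  using mycielskian_walk[OF M.dist_attained[OF assms(1,2)]] assms(3,4)
  by (auto dest: dist_le)

text \<open>For distinct \<open>u\<close> and \<open>v\<close> the distance is the smaller of the length of a lifted shortest path of
  \<open>G\<close> and the length of the detour through the root. Between two
  copies this detour has length 2, and copies are never adjacent.\<close>
lemma dist_Orig_Orig [simp]:
  assumes "u \<in> pverts G" "v \<in> pverts G"
  shows "M.\<delta> (Orig u) (Orig v) = min (\<delta> u v) 4"
proof -
  have "M.\<delta> (Orig u) (Orig v) \<le> 4"
    using M.dist_triangle[of "Orig u" Root "Orig v"] assms by (simp add: M.dist_commute[of Root])
  moreover have "M.\<delta> (Orig u) (Orig v) \<le> \<delta> u v"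
    by (intro M.dist_le relpow_Orig_Orig dist_attained assms)
  ultimately show ?thesis using dist_ge[of "Orig u" "Orig v"] assms by auto
qed

lemma dist_Orig_Copy [simp]:
  assumes "u \<in> pverts G" "v \<in> pverts G"
  shows "M.\<delta> (Orig u) (Copy v) = (if u = v then 2 else min (\<delta> u v) 3)"
proof (cases "u = v")
  case True
  obtain w where w: "(u, w) \<in> parcs G" using ex_neighbour[OF assms(1)] by blast
  then have "(Orig u, Orig w) \<in> parcs (mycielskian G)" "(Orig w, Copy u) \<in> parcs (mycielskian G)"
    by (auto simp: arcs_commute)
  then have "(Orig u, Copy u) \<in> parcs (mycielskian G) ^^ 2" by (auto simp only: numeral_2_eq_2 relpow.simps Id_O_R intro: relcompI)
  then have "M.\<delta> (Orig u) (Copy u) \<le> 2" by (rule M.dist_le)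
  moreover have "(u, u) \<notin> parcs G" using pair_no_loops by force
  then have "M.\<delta> (Orig u) (Copy u) \<noteq> 0" "M.\<delta> (Orig u) (Copy u) \<noteq> 1"
    using M.dist_eq_1_iff[of "Orig u" "Copy u"] assms by auto
  ultimately show ?thesis using True by simp
next
  case False
  have "M.\<delta> (Orig u) (Copy v) \<le> 3"
    using M.dist_triangle[of "Orig u" Root "Copy v"] assms by (simp add: M.dist_commute[of Root])
  moreover have "M.\<delta> (Orig u) (Copy v) \<le> \<delta> u v"
    by (intro M.dist_le relpow_Orig_Copy dist_attained assms) (use assms False in simp)
  ultimately show ?thesis using dist_ge[of "Orig u" "Copy v"] assms False by auto
qed

lemma dist_Copy_Orig [simp]:
  assumes "u \<in> pverts G" "v \<in> pverts G"
  shows "M.\<delta> (Copy u) (Orig v) = (if u = v then 2 else min (\<delta> u v) 3)"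
  using assms by (auto simp: M.dist_commute[of "Copy u"] dist_commute[of v])

lemma dist_Copy_Copy [simp]:
  assumes "u \<in> pverts G" "v \<in> pverts G"
  shows "M.\<delta> (Copy u) (Copy v) = (if u = v then 0 else 2)"
proof (cases "u = v")
  case False
  have "M.\<delta> (Copy u) (Copy v) \<le> 2"
    using M.dist_triangle[of "Copy u" Root "Copy v"] assms by (simp add: M.dist_commute[of Root])
  moreover have "M.\<delta> (Copy u) (Copy v) \<noteq> 0" "M.\<delta> (Copy u) (Copy v) \<noteq> 1"
    using M.dist_eq_1_iff[of "Copy u" "Copy v"] assms False by auto
  ultimately show ?thesis using False by simp
qed simp

lemma dist_Root_Copy [simp]: "u \<in> pverts G \<Longrightarrow> M.\<delta> Root (Copy u) = 1"
  by (simp add: M.dist_commute[of Root])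

end

section \<open>Partitions and root-free sets\<close>

text \<open>The root-free vertex set that a partition encodes: \<open>V1\<close> holds the vertices present with their
  copy, \<open>V2\<close> those of which only the copy is present, \<open>V3\<close> those present without their copy.\<close>
definition myc_set :: "'a set \<Rightarrow> 'a set \<Rightarrow> 'a set \<Rightarrow> 'a myc_vertex set" where
  "myc_set V1 V2 V3 = Orig ` (V1 \<union> V3) \<union> Copy ` (V1 \<union> V2)"

lemma in_myc_set [simp]:
  "Orig u \<in> myc_set V1 V2 V3 \<longleftrightarrow> u \<in> V1 \<union> V3"
  "Copy u \<in> myc_set V1 V2 V3 \<longleftrightarrow> u \<in> V1 \<union> V2"
  "Root \<notin> myc_set V1 V2 V3"
  by (auto simp: myc_set_def)

lemma card_myc_set:
  assumes "finite (V1 \<union> V2 \<union> V3)" "V1 \<inter> V2 = {}" "V1 \<inter> V3 = {}"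
  shows "card (myc_set V1 V2 V3) = 2 * card V1 + card V2 + card V3"
proof -
  have "card (myc_set V1 V2 V3) = card (V1 \<union> V3) + card (V1 \<union> V2)"
    unfolding myc_set_def using assms(1)
    by (subst card_Un_disjoint) (auto simp: card_image inj_on_def)
  then show ?thesis using assms by (simp add: card_Un_disjoint)
qed

lemma mgp_partitionD:
  assumes "mgp_partition G V1 V2 V3 V4"
  shows "V1 \<union> V2 \<union> V3 \<union> V4 = pverts G"
    and "V1 \<inter> V2 = {}" "V1 \<inter> V3 = {}" "V1 \<inter> V4 = {}"
      "V2 \<inter> V3 = {}" "V2 \<inter> V4 = {}" "V3 \<inter> V4 = {}"
    and "\<forall>u v. (u, v) \<in> parcs G \<and> u \<in> V1 \<union> V3 \<and> v \<in> V1 \<union> V3 \<longrightarrow> u \<in> V3 \<and> v \<in> V3"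
    and "\<forall>u v. u \<in> V1 \<union> V3 \<and> v \<in> V2 \<and> (u, v) \<in> parcs G \<longrightarrow>
      (\<forall>w \<in> (V1 \<union> V2) - {u, v}. gdist G u w = 2) \<and> (\<forall>w \<in> V3 - {u}. gdist G u w \<le> 3)"
    and "\<forall>p. shortest_vpath G p \<and> vwalk_length p \<le> 4 \<and> hd p \<in> V1 \<union> V2 \<union> V3 \<and>
        last p \<in> V1 \<union> V2 \<union> V3 \<and> card (set p \<inter> (V1 \<union> V2 \<union> V3)) \<ge> 3 \<longrightarrow>
      (hd p \<in> V2 \<and> last p \<in> V2 \<and> vwalk_length p \<ge> 3) \<or>
      mgp_path_form V1 V2 V3 p \<or> mgp_path_form V1 V2 V3 (rev p)"
  using assms unfolding mgp_partition_def by - (elim conjE; assumption)+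

context nontrivial_connected_graph
begin

text \<open>Suppose \<open>y\<close> lies between \<open>x\<close> and \<open>z\<close> and all three belong to the encoded set. The six facts
  called \<open>OOO\<close>, \<open>OCO\<close> and so on treat the ways in which the three can be original vertices and copies,
  up to exchanging \<open>x\<close> and \<open>z\<close>. As the distances in the Mycielskian are truncated distances of
  \<open>G\<close>, there are two possibilities. Either the truncation does not bite: then the base vertices lie on a
  shortest path of length at most 4 in \<open>G\<close>, and they violate the path condition. Or the
  equation holds because of a detour through the root or because of a triple such as
  \<open>u, v, u'\<close> or \<open>u', v, w'\<close>: then some vertex of \<open>V1 \<union> V3\<close> has a neighbour in \<open>V1 \<union> V2\<close>, and the
  conditions on edges are violated.\<close>
lemma general_position_of_mgp:
  assumes "mgp_partition G V1 V2 V3 V4"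
  shows "general_position_set (mycielskian G) (myc_set V1 V2 V3)"
proof -
  note cover = mgp_partitionD(1)[OF assms] and disjoint = mgp_partitionD(2-7)[OF assms]
    and edges = mgp_partitionD(8)[OF assms] and distances = mgp_partitionD(9)[OF assms]
    and paths = mgp_partitionD(10)[OF assms]
  have V: "u \<in> pverts G" if "u \<in> V1 \<union> V2 \<union> V3" for u using that cover by blast
  have arc: "(u, v) \<in> parcs G" if "u \<in> V1 \<union> V2 \<union> V3" "v \<in> V1 \<union> V2 \<union> V3" "\<delta> u v = 1" for u v
    using dist_eq_1_iff[of u v] V that by blast
  have edge: "\<delta> u v \<noteq> 1" if "u \<in> V1 \<union> V3" "v \<in> V1" for u v
    using that edges[THEN spec, THEN spec, of u v] disjoint(2) arc[of u v] by blast
  have pos: "\<delta> u v \<ge> 1" if "u \<in> V1 \<union> V2 \<union> V3" "v \<in> V1 \<union> V2 \<union> V3" "u \<noteq> v" for u v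
  proof -
    have "\<delta> u v \<noteq> 0" using dist_eq_0_iff[OF V V] that by blast
    then show ?thesis by simp
  qed
  have tri: "\<delta> u w \<le> \<delta> u v + \<delta> v w"
    if "u \<in> V1 \<union> V2 \<union> V3" "v \<in> V1 \<union> V2 \<union> V3" "w \<in> V1 \<union> V2 \<union> V3" for u v w
    using dist_triangle[OF V V V] that by blast
  have near2: "\<delta> u w = 2"
    if "u \<in> V1 \<union> V3" "v \<in> V2" "\<delta> u v = 1" "w \<in> V1 \<union> V2" "w \<noteq> u" "w \<noteq> v" for u v w
  proof -
    have "gdist G u w = 2" using distances[THEN spec, THEN spec, of u v] arc[of u v] that by blast
    moreover have "u \<in> pverts G" "w \<in> pverts G" using V that by blast+
    ultimately show ?thesis by (simp only: gdist_numeral_iff)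
  qed
  have near3: "\<delta> u w \<le> 3"
    if "u \<in> V1 \<union> V3" "v \<in> V2" "\<delta> u v = 1" "w \<in> V3" "w \<noteq> u" for u v w
  proof -
    have "gdist G u w \<le> 3" using distances[THEN spec, THEN spec, of u v] arc[of u v] that by blast
    moreover have "u \<in> pverts G" "w \<in> pverts G" using V that by blast+
    ultimately show ?thesis by (simp only: gdist_numeral_iff)
  qed
  \<comment> \<open>Any vertex of the three classes that lies between two others at distance at most 4
    triggers the path condition.\<close>
  have form: "\<exists>p. shortest_vpath G p \<and> hd p = u \<and> last p = w \<and> length p = Suc (\<delta> u w)
      \<and> p ! \<delta> u c = c \<and>
      ((u \<in> V2 \<and> w \<in> V2 \<and> \<delta> u w \<ge> 3) \<or>
       mgp_path_form V1 V2 V3 p \<or> mgp_path_form V1 V2 V3 (rev p))"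
    if h: "u \<in> V1 \<union> V2 \<union> V3" "c \<in> V1 \<union> V2 \<union> V3" "w \<in> V1 \<union> V2 \<union> V3"
      "c \<noteq> u" "c \<noteq> w" "\<delta> u w \<le> 4" "\<delta> u w = \<delta> u c + \<delta> c w" for u c w
  proof -
    obtain p where p: "shortest_vpath G p" "hd p = u" "last p = w"
      "length p = Suc (\<delta> u w)" "p ! \<delta> u c = c"
      using ex_shortest_vpath_through[of u c w] h V by blast
    have "c \<in> set p" using p h nth_mem[of "\<delta> u c" p] by simp
    moreover have "p \<noteq> []" using p by auto
    ultimately have "{u, c, w} \<subseteq> set p \<inter> (V1 \<union> V2 \<union> V3)" using p h by auto
    then have "card {u, c, w} \<le> card (set p \<inter> (V1 \<union> V2 \<union> V3))" by (intro card_mono) auto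
    moreover have "u \<noteq> w" using h pos[of u c] by auto
    ultimately have "3 \<le> card (set p \<inter> (V1 \<union> V2 \<union> V3))" using h by simp
    then show ?thesis using paths[THEN spec, of p] p h by (intro exI[of _ p]) auto
  qed
  \<comment> \<open>Every exception in the path condition has an end in \<open>V2\<close>.\<close>
  have free_outer: "\<delta> u w \<noteq> \<delta> u c + \<delta> c w"
    if h: "u \<in> V1 \<union> V3" "w \<in> V1 \<union> V3" "c \<in> V1 \<union> V2 \<union> V3" "c \<noteq> u" "c \<noteq> w" "\<delta> u w \<le> 4" for u c w
  proof
    assume "\<delta> u w = \<delta> u c + \<delta> c w"
    then obtain p where p: "hd p = u" "last p = w"
      "(u \<in> V2 \<and> w \<in> V2 \<and> \<delta> u w \<ge> 3) \<or> mgp_path_form V1 V2 V3 p \<or> mgp_path_form V1 V2 V3 (rev p)"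
      using form[of u c w] h by blast
    then have "u \<in> V2 \<or> w \<in> V2"
      unfolding mgp_path_form_def by (auto simp: rev_swap)
    then show False using h disjoint(1,4) by blast
  qed
  \<comment> \<open>Of the exceptional shapes, only those of length at most 3 are relevant here, and there
    the interior members of the three classes lie in \<open>V2\<close>.\<close>
  have free_mixed: "\<delta> a w \<noteq> \<delta> a c + \<delta> c w"
    if h: "a \<in> V2" "w \<in> V1 \<union> V3" "c \<in> V1 \<union> V3" "c \<noteq> a" "c \<noteq> w" "\<delta> a w \<le> 3" for a c w
  proof
    assume eq: "\<delta> a w = \<delta> a c + \<delta> c w"
    then obtain p where p: "hd p = a" "last p = w" "length p = Suc (\<delta> a w)" "p ! \<delta> a c = c"
      "(a \<in> V2 \<and> w \<in> V2 \<and> \<delta> a w \<ge> 3) \<or> mgp_path_form V1 V2 V3 p \<or> mgp_path_form V1 V2 V3 (rev p)"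
      using form[of a c w] h by auto
    have "w \<notin> V2" "c \<notin> V2" using h disjoint(1,4) by blast+
    then have "mgp_path_form V1 V2 V3 p" using p
      unfolding mgp_path_form_def by (auto simp: rev_swap)
    moreover have "\<delta> a c \<ge> 1" "\<delta> c w \<ge> 1" using pos h by auto
    then have "\<delta> a c = 1 \<or> \<delta> a c = 2" "\<delta> a c < \<delta> a w" using h(6) eq by linarith+
    ultimately show False
      using p \<open>c \<notin> V2\<close> h unfolding mgp_path_form_def by auto
  qed
  let ?S = "myc_set V1 V2 V3"
  have OOO: "M.\<delta> (Orig u) (Orig w) \<noteq> M.\<delta> (Orig u) (Orig c) + M.\<delta> (Orig c) (Orig w)"
    if h: "u \<in> V1 \<union> V3" "w \<in> V1 \<union> V3" "c \<in> V1 \<union> V3" "c \<noteq> u" "c \<noteq> w" for u c w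
  proof -
    have W: "u \<in> V1 \<union> V2 \<union> V3" "w \<in> V1 \<union> V2 \<union> V3" "c \<in> V1 \<union> V2 \<union> V3" using h by auto
    have "\<delta> u w \<le> 4 \<Longrightarrow> \<delta> u w \<noteq> \<delta> u c + \<delta> c w"
      using free_outer[of u w c] h W by blast
    moreover have "\<delta> u c \<ge> 1" "\<delta> c w \<ge> 1" using pos W h by metis+
    moreover note tri[OF W(1,3,2)]
    ultimately have "min (\<delta> u w) 4 \<noteq> min (\<delta> u c) 4 + min (\<delta> c w) 4" by linarith
    then show ?thesis using V W by simp
  qed
  have OCO: "M.\<delta> (Orig u) (Orig w) \<noteq> M.\<delta> (Orig u) (Copy c) + M.\<delta> (Copy c) (Orig w)"
    if h: "u \<in> V1 \<union> V3" "w \<in> V1 \<union> V3" "c \<in> V1 \<union> V2" for u c w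
  proof -
    have W: "u \<in> V1 \<union> V2 \<union> V3" "w \<in> V1 \<union> V2 \<union> V3" "c \<in> V1 \<union> V2 \<union> V3" using h by auto
    have V': "u \<in> pverts G" "w \<in> pverts G" "c \<in> pverts G" using V W by auto
    consider "u = w" | "c = u" "u \<noteq> w" | "c = w" "u \<noteq> w" | "c \<noteq> u" "c \<noteq> w" "u \<noteq> w" by blast
    then show ?thesis
    proof cases
      case 1
      then show ?thesis using V' M.dist_eq_0_iff[of "Orig u" "Copy c"] by simp
    next
      case 2
      have "min (\<delta> u w) 4 \<noteq> 2 + min (\<delta> u w) 3" by linarith
      with 2 V' show ?thesis by simp
    next
      case 3
      have "min (\<delta> u w) 4 \<noteq> min (\<delta> u w) 3 + 2" by linarith
      with 3 V' show ?thesis by simp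
    next
      case 4
      \<comment> \<open>An end adjacent to \<open>c\<close> may reach the other end through the root and \<open>c'\<close>; the distance
        condition keeps the ends too close in \<open>G\<close> for that detour to be shortest.\<close>
      have far: "\<delta> x y \<le> 3"
        if "\<delta> x c = 1" "x \<in> V1 \<union> V3" "y \<in> V1 \<union> V3" "x \<noteq> y" "c \<noteq> x" "c \<noteq> y" for x y
      proof -
        have "c \<in> V2" using edge[of x c] that h by blast
        then have "y \<in> V3 \<Longrightarrow> \<delta> x y \<le> 3" "y \<in> V1 \<Longrightarrow> \<delta> x y = 2"
          using near3[of x c y] near2[of x c y] that by blast+
        then show ?thesis using that by auto
      qed
      have "\<delta> u c = 1 \<Longrightarrow> \<delta> u w \<le> 3" "\<delta> c w = 1 \<Longrightarrow> \<delta> u w \<le> 3"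
        using far[of u w] far[of w u] h 4 dist_commute[of w] by metis+
      moreover have "\<delta> u w \<le> 4 \<Longrightarrow> \<delta> u w \<noteq> \<delta> u c + \<delta> c w"
        using free_outer[of u w c] h W 4 by blast
      moreover have "\<delta> u c \<ge> 1" "\<delta> c w \<ge> 1" using pos W 4 by metis+
      moreover note tri[OF W(1,3,2)]
      ultimately have "min (\<delta> u w) 4 \<noteq> min (\<delta> u c) 3 + min (\<delta> c w) 3" by linarith
      then show ?thesis using V' 4 by simp
    qed
  qed
  have OOC: "M.\<delta> (Orig u) (Copy w) \<noteq> M.\<delta> (Orig u) (Orig c) + M.\<delta> (Orig c) (Copy w)"
    if h: "u \<in> V1 \<union> V3" "w \<in> V1 \<union> V2" "c \<in> V1 \<union> V3" "c \<noteq> u" for u c w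
  proof -
    have W: "u \<in> V1 \<union> V2 \<union> V3" "w \<in> V1 \<union> V2 \<union> V3" "c \<in> V1 \<union> V2 \<union> V3" using h by auto
    have V': "u \<in> pverts G" "w \<in> pverts G" "c \<in> pverts G" using V W by auto
    consider "c = w" | "u = w" | "c \<noteq> w" "u \<noteq> w" by blast
    then show ?thesis
    proof cases
      case 1
      have "min (\<delta> u w) 3 \<noteq> min (\<delta> u w) 4 + 2" by linarith
      with 1 h V' show ?thesis by simp
    next
      case 2
      then have "u \<in> V1" using h disjoint(1,4) by blast
      then have "\<delta> u c \<noteq> 1" using edge[of c u] h dist_commute[of u c] by simp
      moreover have "\<delta> u c \<ge> 1" using pos W h by metis
      ultimately have "2 \<noteq> min (\<delta> u c) 4 + min (\<delta> u c) 3" by linarith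
      then show ?thesis using 2 h V' by (simp add: dist_commute[of c])
    next
      case 3
      have "\<delta> u w \<noteq> \<delta> u c + \<delta> c w" if "\<delta> u w \<le> 3"
      proof (cases "w \<in> V1")
        case True
        then show ?thesis using free_outer[of u w c] h W 3 that by auto
      next
        case False
        then have "w \<in> V2" using h by blast
        then show ?thesis using free_mixed[of w u c] h 3 that
          by (simp add: dist_commute[of w] dist_commute[of c u])
      qed
      moreover have "\<delta> u c \<ge> 1" "\<delta> c w \<ge> 1" using pos W h 3 by metis+
      moreover note tri[OF W(1,3,2)]
      ultimately have "min (\<delta> u w) 3 \<noteq> min (\<delta> u c) 4 + min (\<delta> c w) 3" by linarith
      then show ?thesis using V' 3 by simp
    qed
  qed
  have OCC: "M.\<delta> (Orig u) (Copy w) \<noteq> M.\<delta> (Orig u) (Copy c) + M.\<delta> (Copy c) (Copy w)"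
    if h: "u \<in> V1 \<union> V3" "w \<in> V1 \<union> V2" "c \<in> V1 \<union> V2" "c \<noteq> w" for u c w
  proof
    assume eq: "M.\<delta> (Orig u) (Copy w) = M.\<delta> (Orig u) (Copy c) + M.\<delta> (Copy c) (Copy w)"
    have V': "u \<in> pverts G" "w \<in> pverts G" "c \<in> pverts G" using h V by auto
    have "\<delta> u c \<ge> 1" if "u \<noteq> c" using pos[of u c] h that by blast
    then have *: "u \<noteq> w" "u \<noteq> c" "\<delta> u w \<ge> 3" "\<delta> u c = 1"
      using eq h V' by (auto split: if_splits)
    then have "c \<in> V2" using edge[of u c] h by auto
    then show False using near2[of u c w] * h by auto
  qed
  have COC: "M.\<delta> (Copy a) (Copy b) \<noteq> M.\<delta> (Copy a) (Orig c) + M.\<delta> (Orig c) (Copy b)"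
    if h: "a \<in> V1 \<union> V2" "b \<in> V1 \<union> V2" "c \<in> V1 \<union> V3" for a b c
  proof
    assume eq: "M.\<delta> (Copy a) (Copy b) = M.\<delta> (Copy a) (Orig c) + M.\<delta> (Orig c) (Copy b)"
    have V': "a \<in> pverts G" "b \<in> pverts G" "c \<in> pverts G" using h V by auto
    have "\<delta> c a \<ge> 1" if "a \<noteq> c" using pos[of c a] h that by blast
    moreover have "\<delta> c b \<ge> 1" if "b \<noteq> c" using pos[of c b] h that by blast
    ultimately have *: "a \<noteq> b" "a \<noteq> c" "b \<noteq> c" "\<delta> c a = 1" "\<delta> c b = 1"
      using eq V' by (auto simp: dist_commute[of a] split: if_splits)
    then have "a \<in> V2" using edge[of c a] h by auto
    then show False using near2[of c a b] * h by auto
  qed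
  have CCC: "M.\<delta> (Copy a) (Copy b) \<noteq> M.\<delta> (Copy a) (Copy c) + M.\<delta> (Copy c) (Copy b)"
    if "a \<in> V1 \<union> V2" "b \<in> V1 \<union> V2" "c \<in> V1 \<union> V2" "c \<noteq> a" "c \<noteq> b" for a b c
  proof -
    have "a \<in> pverts G" "b \<in> pverts G" "c \<in> pverts G" using that V by auto
    then show ?thesis using that by simp
  qed
  have "M.\<delta> x z \<noteq> M.\<delta> x y + M.\<delta> y z" if "x \<in> ?S" "y \<in> ?S" "z \<in> ?S" "x \<noteq> y" "y \<noteq> z" for x y z
  proof -
    \<comment> \<open>Betweenness is symmetric in the outer vertices, which turns the cases that end in an
      original vertex into cases that start with one.\<close>
    have sw: "M.\<delta> x z \<noteq> M.\<delta> x y + M.\<delta> y z \<longleftrightarrow> M.\<delta> z x \<noteq> M.\<delta> z y + M.\<delta> y x"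
      by (simp add: M.dist_commute[of z x] M.dist_commute[of z y] M.dist_commute[of y x] add.commute)
    show ?thesis
    proof (cases x)
      case (Orig u)
      show ?thesis
        by (cases y; cases z) (use that Orig OOO OCO OOC OCC in \<open>simp_all del: dist_Orig_Orig dist_Orig_Copy dist_Copy_Orig dist_Copy_Copy\<close>)
    next
      case (Copy u)
      show ?thesis
      proof (cases z)
        case (Orig w)
        then show ?thesis
          by (subst sw, cases y) (use that Copy OOC OCC in \<open>simp_all del: dist_Orig_Orig dist_Orig_Copy dist_Copy_Orig dist_Copy_Copy\<close>)
      next
        case (Copy w)
        then show ?thesis
          by (cases y) (use that \<open>x = Copy u\<close> COC CCC in \<open>simp_all del: dist_Orig_Orig dist_Orig_Copy dist_Copy_Orig dist_Copy_Copy\<close>)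
      qed (use that in simp)
    qed (use that in simp)
  qed
  moreover have "?S \<subseteq> pverts (mycielskian G)" using cover by (auto simp: myc_set_def)
  ultimately show ?thesis unfolding M.general_position_set_iff by blast
qed

text \<open>Each violation of a condition exhibits three collinear members of the encoded set. Two adjacent
  vertices \<open>u\<close> in \<open>V1 \<union> V3\<close> and \<open>v\<close> in \<open>V1\<close> give \<open>v, u, v'\<close>. A neighbour \<open>v\<close> in \<open>V2\<close> of
  \<open>u\<close> in \<open>V1 \<union> V3\<close> gives \<open>v', u, w'\<close> if also \<open>w\<close> is adjacent to \<open>u\<close>, and \<open>u, v', w'\<close> or \<open>u, v', w\<close> if
  \<open>w\<close> is so far away that the detour through the root is shortest. For the path condition, the ends and
  one interior vertex, all in \<open>V1 \<union> V2 \<union> V3\<close>, are lifted to members of the set; the exceptional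
  shapes are those for which no such lift preserves betweenness.\<close>
lemma mgp_of_general_position:
  assumes part: "V1 \<union> V2 \<union> V3 \<union> V4 = pverts G"
      "V1 \<inter> V2 = {}" "V1 \<inter> V3 = {}" "V1 \<inter> V4 = {}"
      "V2 \<inter> V3 = {}" "V2 \<inter> V4 = {}" "V3 \<inter> V4 = {}"
    and "general_position_set (mycielskian G) (myc_set V1 V2 V3)"
  shows "mgp_partition G V1 V2 V3 V4"
proof -
  let ?W = "V1 \<union> V2 \<union> V3" and ?S = "myc_set V1 V2 V3"
  have gp: "M.\<delta> x z \<noteq> M.\<delta> x y + M.\<delta> y z"
    if "x \<in> ?S" "y \<in> ?S" "z \<in> ?S" "x \<noteq> y" "y \<noteq> z" for x y z
    using assms(8) that unfolding M.general_position_set_iff by blast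
  have V: "u \<in> pverts G" if "u \<in> ?W" for u using that part(1) by blast
  have edge: "\<delta> u v \<noteq> 1" if "u \<in> V1 \<union> V3" "v \<in> V1" for u v
  proof
    assume "\<delta> u v = 1"
    moreover have "u \<in> pverts G" "v \<in> pverts G" using V that by blast+
    moreover have "u \<noteq> v" using \<open>\<delta> u v = 1\<close> by auto
    ultimately show False using gp[of "Orig v" "Orig u" "Copy v"] that
      by (simp add: dist_commute[of v u])
  qed
  have near2: "\<delta> u w = 2"
    if h: "u \<in> V1 \<union> V3" "v \<in> V2" "\<delta> u v = 1" "w \<in> V1 \<union> V2" "w \<noteq> u" "w \<noteq> v" for u v w
  proof -
    have V': "u \<in> pverts G" "v \<in> pverts G" "w \<in> pverts G" using V h by blast+
    have "u \<noteq> v" using h(3) by auto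
    have "\<delta> u w \<noteq> 0" using V' h(5) by simp
    moreover have "\<delta> u w \<noteq> 1"
      using gp[of "Copy v" "Orig u" "Copy w"] h V' \<open>u \<noteq> v\<close> by (auto simp: dist_commute[of v u])
    moreover have "\<not> 3 \<le> \<delta> u w"
      using gp[of "Orig u" "Copy v" "Copy w"] h V' \<open>u \<noteq> v\<close> by auto
    ultimately show ?thesis by linarith
  qed
  have near3: "\<delta> u w \<le> 3"
    if h: "u \<in> V1 \<union> V3" "v \<in> V2" "\<delta> u v = 1" "w \<in> V3" "w \<noteq> u" for u v w
  proof (rule ccontr)
    assume far: "\<not> \<delta> u w \<le> 3"
    have V': "u \<in> pverts G" "v \<in> pverts G" "w \<in> pverts G" using V h by blast+
    have "u \<noteq> v" "v \<noteq> w" using h far by auto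
    moreover have "\<delta> v w \<ge> 3" using dist_triangle[OF V'] h far by linarith
    ultimately show False using gp[of "Orig u" "Copy v" "Orig w"] h V' far by simp
  qed
  have arc1: "\<delta> u v = 1" if "(u, v) \<in> parcs G" for u v
    using that dist_eq_1_iff in_arcsD1 in_arcsD2 by blast
  \<comment> \<open>The path condition is about a path and its reverse. This notion of a shortest path, in
    terms of distances only, is visibly invariant under reversal.\<close>
  define geo where "geo p \<longleftrightarrow> set p \<subseteq> pverts G \<and> p \<noteq> [] \<and>
    (\<forall>i j. i \<le> j \<longrightarrow> j < length p \<longrightarrow> \<delta> (p ! i) (p ! j) = j - i)" for p
  have geo_rev: "geo (rev p)" if "geo p" for p
    unfolding geo_def
  proof (intro conjI allI impI)
    fix i j assume ij: "i \<le> j" "j < length (rev p)"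
    then have "\<delta> (p ! (length p - Suc j)) (p ! (length p - Suc i)) = j - i"
      using that unfolding geo_def by auto
    then show "\<delta> (rev p ! i) (rev p ! j) = j - i"
      using ij by (simp add: rev_nth dist_commute)
  qed (use that in \<open>auto simp: geo_def\<close>)
  \<comment> \<open>A path from \<open>V2\<close> to \<open>V1 \<union> V3\<close> lifts to one from a copy to an original vertex. This lift is
    shortest up to length 3 and can pass through any original vertex, but through a copy
    only from the third vertex on.\<close>
  have mixed: "mgp_path_form V1 V2 V3 p"
    if p: "geo p" "length p \<le> 5" "hd p \<in> V2" "last p \<in> V1 \<union> V3"
      and i: "0 < i" "Suc i < length p" "p ! i \<in> ?W" for p i
  proof -
    let ?l = "length p - 1"
    have p0: "hd p = p ! 0" "last p = p ! ?l"
      using p by (auto simp: geo_def hd_conv_nth last_conv_nth)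
    have d: "\<delta> (p ! j) (p ! k) = k - j" if "j \<le> k" "k < length p" for j k
      using p(1) that unfolding geo_def by blast
    have ne: "p ! j \<noteq> p ! k" if "j < k" "k < length p" for j k
      using d[of j k] that by auto
    have inV: "p ! j \<in> pverts G" if "j < length p" for j
      using p(1) that unfolding geo_def by (meson nth_mem subsetD)
    have short: "k = 1 \<and> p ! k \<in> V2" if k: "0 < k" "Suc k < length p" "p ! k \<in> ?W" "?l \<le> 3" for k
    proof -
      have V': "p ! 0 \<in> pverts G" "p ! k \<in> pverts G" "p ! ?l \<in> pverts G"
      proof -
        have "0 < length p" "k < length p" "?l < length p" using k by linarith+
        then show "p ! 0 \<in> pverts G" "p ! k \<in> pverts G" "p ! ?l \<in> pverts G" using inV by blast+
      qed
      have n: "p ! 0 \<noteq> p ! k" "p ! k \<noteq> p ! ?l" "p ! 0 \<noteq> p ! ?l" using ne k by auto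
      have D: "\<delta> (p ! 0) (p ! k) = k" "\<delta> (p ! k) (p ! ?l) = ?l - k" "\<delta> (p ! 0) (p ! ?l) = ?l"
        using d[of 0 k] d[of k ?l] d[of 0 ?l] k by auto
      have "p ! k \<notin> V1 \<union> V3"
        using gp[of "Copy (p ! 0)" "Orig (p ! k)" "Orig (p ! ?l)"] p p0 V' n D k by auto
      then have "p ! k \<in> V2" using k by blast
      moreover have "\<not> 2 \<le> k"
      proof
        assume "2 \<le> k"
        then have "k = 2" "?l = 3" using k by linarith+
        then show False
          using gp[of "Copy (p ! 0)" "Copy (p ! k)" "Orig (p ! ?l)"] p p0 V' n D \<open>p ! k \<in> V2\<close> by simp
      qed
      ultimately show ?thesis using k by linarith
    qed
    from i p(2) consider "length p = 3" | "length p = 4" | "length p = 5" by linarith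
    then show ?thesis
    proof cases
      case 1
      then have "p = [p ! 0, p ! 1, p ! 2]" by (rule list_of_small_length)
      moreover have "?l \<le> 3" using 1 by simp
      then have "i = 1 \<and> p ! i \<in> V2" by (rule short[OF i])
      then have "p ! 1 \<in> V2" by metis
      ultimately show ?thesis using p(3) p0 unfolding mgp_path_form_def by metis
    next
      case 2
      then have "p = [p ! 0, p ! 1, p ! 2, p ! 3]" by (rule list_of_small_length)
      moreover have "?l \<le> 3" using 2 by simp
      then have "i = 1 \<and> p ! i \<in> V2" by (rule short[OF i])
      then have "p ! 1 \<in> V2" by metis
      moreover have "p ! 2 \<notin> ?W" using short[of 2] 2 by auto
      moreover have "p ! 3 \<in> V1 \<union> V3" using p(4) p0 2 by simp
      ultimately show ?thesis using p(3) p0 unfolding mgp_path_form_def by metis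
    next
      case 3
      then have "p = [p ! 0, p ! 1, p ! 2, p ! 3, p ! 4]" by (rule list_of_small_length)
      moreover have e: "p ! 4 \<in> V1 \<union> V3" "p ! 0 \<in> V2" using p(3,4) p0 3 by simp_all
      \<comment> \<open>The lift of a path of length 4 is not shortest, so only the edge at the far end
        is restricted.\<close>
      moreover have d43: "\<delta> (p ! 4) (p ! 3) = 1" "\<delta> (p ! 4) (p ! 0) = 4"
        using d[of 3 4] d[of 0 4] 3 by (simp_all add: dist_commute)
      have "p ! 3 \<notin> V1" using edge[OF e(1)] d43(1) by blast
      moreover have "p ! 3 \<notin> V2"
        using near2[OF e(1) _ d43(1), of "p ! 0"] d43(2) e ne[of 0 3] ne[of 0 4] 3 by auto
      ultimately show ?thesis unfolding mgp_path_form_def by (metis UnE)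
    qed
  qed
  have path: "(hd p \<in> V2 \<and> last p \<in> V2 \<and> vwalk_length p \<ge> 3) \<or>
      mgp_path_form V1 V2 V3 p \<or> mgp_path_form V1 V2 V3 (rev p)"
    if p: "shortest_vpath G p" "vwalk_length p \<le> 4" "hd p \<in> ?W" "last p \<in> ?W"
      "card (set p \<inter> ?W) \<ge> 3" for p
  proof -
    have sp: "vwalk p G" "\<delta> (hd p) (last p) = length p - 1"
      using p(1) unfolding shortest_vpath_iff by auto
    then have "geo p" using dist_nth_of_geodesic[OF sp] unfolding geo_def by (auto simp: vwalk_def)
    then have p0: "hd p = p ! 0" "last p = p ! (length p - 1)" "p \<noteq> []"
      by (auto simp: geo_def hd_conv_nth last_conv_nth)
    have l: "length p \<le> 5" using p(2) by simp
    have "\<not> set p \<inter> ?W \<subseteq> {hd p, last p}"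
    proof
      assume "set p \<inter> ?W \<subseteq> {hd p, last p}"
      then have "card (set p \<inter> ?W) \<le> card {hd p, last p}" by (intro card_mono) auto
      also have "\<dots> \<le> 2" by (simp add: card_insert_if)
      finally show False using p(5) by simp
    qed
    then obtain c where "c \<in> set p" "c \<in> ?W" "c \<noteq> hd p" "c \<noteq> last p"
      by blast
    then obtain i where i: "i < length p" "p ! i \<in> ?W" "p ! i \<noteq> hd p" "p ! i \<noteq> last p"
      by (metis in_set_conv_nth)
    then have "i \<noteq> 0" "i \<noteq> length p - 1" using p0 by metis+
    with i have i': "0 < i" "Suc i < length p" by linarith+
    let ?a = "hd p" and ?b = "last p" and ?c = "p ! i"
    have D: "\<delta> ?a ?c = i" "\<delta> ?c ?b = length p - 1 - i" "\<delta> ?a ?b = length p - 1"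
      using \<open>geo p\<close> i' p0 unfolding geo_def by auto
    have V': "?a \<in> pverts G" "?b \<in> pverts G" "?c \<in> pverts G" using V p i by blast+
    have n: "?a \<noteq> ?b" using D i' by auto
    consider "?a \<in> V1 \<union> V3" "?b \<in> V1 \<union> V3" | "?a \<in> V2" "?b \<in> V1 \<union> V3"
      | "?a \<in> V1 \<union> V3" "?b \<in> V2" | "?a \<in> V2" "?b \<in> V2" using p(3,4) by blast
    then show ?thesis
    proof cases
      case 1
      have "?c \<notin> V1 \<union> V3" using gp[of "Orig ?a" "Orig ?c" "Orig ?b"] 1 D V' i i' l by auto
      moreover have "?c \<notin> V2"
        using gp[of "Orig ?a" "Copy ?c" "Orig ?b"] 1 D V' i i' l by auto
      ultimately show ?thesis using i by blast
    next
      case 2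
      then show ?thesis using mixed[OF \<open>geo p\<close> l _ _ i' i(2)] by blast
    next
      case 3
      have "rev p ! (length p - 1 - i) = ?c" using i' by (simp add: rev_nth)
      then have "mgp_path_form V1 V2 V3 (rev p)"
        using 3 l i i' p0 by (intro mixed[of "rev p" "length p - 1 - i"] geo_rev \<open>geo p\<close>)
          (auto simp: hd_rev last_rev)
      then show ?thesis by blast
    next
      case 4
      show ?thesis
      proof (cases "length p = 3")
        case True
        then have "i = 1" using i' by simp
        have "?c \<notin> V1 \<union> V3"
          using gp[of "Copy ?a" "Orig ?c" "Copy ?b"] 4 D V' i True \<open>i = 1\<close> n by auto
        then have "p ! 1 \<in> V2" using i \<open>i = 1\<close> by blast
        moreover have "p = [p ! 0, p ! 1, p ! 2]" using True
          by (rule list_of_small_length)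
        ultimately show ?thesis using 4 p0 unfolding mgp_path_form_def by metis
      next
        case False
        then show ?thesis using 4 i' by auto
      qed
    qed
  qed
  have near2': "gdist G u w = 2"
    if "u \<in> V1 \<union> V3" "v \<in> V2" "(u, v) \<in> parcs G" "w \<in> V1 \<union> V2" "w \<noteq> u" "w \<noteq> v" for u v w
  proof -
    have "u \<in> pverts G" "w \<in> pverts G" using V that by blast+
    from gdist_numeral_iff(1)[OF this] near2[of u v w] arc1[of u v] that
    show ?thesis by blast
  qed
  have near3': "gdist G u w \<le> 3"
    if "u \<in> V1 \<union> V3" "v \<in> V2" "(u, v) \<in> parcs G" "w \<in> V3" "w \<noteq> u" for u v w
  proof -
    have "u \<in> pverts G" "w \<in> pverts G" using V that by blast+
    from gdist_numeral_iff(2)[OF this] near3[of u v w] arc1[of u v] that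
    show ?thesis by blast
  qed
  have edge': "u \<in> V3 \<and> v \<in> V3"
    if "(u, v) \<in> parcs G" "u \<in> V1 \<union> V3" "v \<in> V1 \<union> V3" for u v
    using edge[of u v] edge[of v u] arc1[of u v] arc1[of v u] arcs_commute[of u v] that by blast
  have c1: "\<forall>u v. (u, v) \<in> parcs G \<and> u \<in> V1 \<union> V3 \<and> v \<in> V1 \<union> V3 \<longrightarrow> u \<in> V3 \<and> v \<in> V3"
    by (intro allI impI, elim conjE) (rule edge')
  have c2: "\<forall>u v. u \<in> V1 \<union> V3 \<and> v \<in> V2 \<and> (u, v) \<in> parcs G \<longrightarrow>
      (\<forall>w \<in> (V1 \<union> V2) - {u, v}. gdist G u w = 2) \<and> (\<forall>w \<in> V3 - {u}. gdist G u w \<le> 3)"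
  proof (intro allI impI conjI ballI; elim conjE)
    fix u v w
    assume h: "u \<in> V1 \<union> V3" "v \<in> V2" "(u, v) \<in> parcs G"
    show "gdist G u w = 2" if "w \<in> (V1 \<union> V2) - {u, v}"
      using near2'[OF h, of w] that by simp
    show "gdist G u w \<le> 3" if "w \<in> V3 - {u}"
      using near3'[OF h, of w] that by simp
  qed
  have c3: "\<forall>p. shortest_vpath G p \<and> vwalk_length p \<le> 4 \<and> hd p \<in> ?W \<and> last p \<in> ?W \<and>
        card (set p \<inter> ?W) \<ge> 3 \<longrightarrow>
      (hd p \<in> V2 \<and> last p \<in> V2 \<and> vwalk_length p \<ge> 3) \<or>
      mgp_path_form V1 V2 V3 p \<or> mgp_path_form V1 V2 V3 (rev p)"
    by (intro allI impI, elim conjE) (rule path)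
  show ?thesis
    unfolding mgp_partition_def by (intro conjI part c1 c2 c3)
qed

end

section \<open>Sets that contain the root\<close>

context nontrivial_connected_graph
begin

lemma mgp_value:
  assumes "mgp_partition G V1 V2 V3 V4"
  shows "int (card (pverts G)) + int (card V1) - int (card V4) = int (card (myc_set V1 V2 V3))"
proof -
  note P = mgp_partitionD(1-7)[OF assms]
  have fin: "finite V1" "finite V2" "finite V3" "finite V4"
    using pair_finite_verts P(1) by (metis finite_Un)+
  have "(V1 \<union> V2 \<union> V3) \<inter> V4 = {}" "(V1 \<union> V2) \<inter> V3 = {}" using P by blast+
  then have "card (pverts G) = card V1 + card V2 + card V3 + card V4"
    using fin P(2) by (simp add: card_Un_disjoint flip: P(1))
  then show ?thesis using card_myc_set[of V1 V2 V3] fin P(2,3) by simp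
qed

text \<open>Any two copies are at distance 2.\<close>
lemma copies_general_position:
  "general_position_set (mycielskian G) (myc_set {} (pverts G) {})"
  unfolding M.general_position_set_iff by (auto simp: myc_set_def)

text \<open>The vertex \<open>v\<close> is within distance 2 of every copy and adjacent to only one, so it
  is neither between two copies nor further from one copy than from another by 2.\<close>
lemma leaf_general_position:
  assumes "v \<in> pverts G" and leaf: "\<And>y. (v, y) \<in> parcs G \<Longrightarrow> y = x"
    and near: "\<And>w. w \<in> pverts G \<Longrightarrow> \<delta> v w \<le> 2"
  shows "general_position_set (mycielskian G) (myc_set {v} (pverts G - {v}) {})"
    (is "general_position_set _ ?S")
proof -
  have S: "?S = insert (Orig v) (Copy ` pverts G)" using assms(1) by (auto simp: myc_set_def)
  have d: "M.\<delta> (Orig v) (Copy c) = 1 \<or> M.\<delta> (Orig v) (Copy c) = 2" if "c \<in> pverts G" for c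
  proof (cases "c = v")
    case False
    then have "\<delta> v c \<noteq> 0" using assms(1) that by simp
    then have "\<delta> v c = 1 \<or> \<delta> v c = 2" using near[OF that] by linarith
    then show ?thesis using False assms(1) that by auto
  qed (use assms(1) in simp)
  have only: "c = x" if "c \<in> pverts G" "M.\<delta> (Orig v) (Copy c) = 1" for c
    using that leaf[of c] M.dist_eq_1_iff[of "Orig v" "Copy c"] assms(1) by simp
  have OCC: "M.\<delta> (Orig v) (Copy b) \<noteq> M.\<delta> (Orig v) (Copy a) + M.\<delta> (Copy a) (Copy b)"
    if "a \<in> pverts G" "b \<in> pverts G" "a \<noteq> b" for a b
    using d[OF that(1)] d[OF that(2)] dist_Copy_Copy[OF that(1,2)] that(3) by auto
  have COC: "M.\<delta> (Copy a) (Copy b) \<noteq> M.\<delta> (Orig v) (Copy a) + M.\<delta> (Orig v) (Copy b)"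
    if "a \<in> pverts G" "b \<in> pverts G" for a b
  proof (cases "a = b")
    case True
    then show ?thesis using d[of a] that by auto
  next
    case False
    then have "\<not> (M.\<delta> (Orig v) (Copy a) = 1 \<and> M.\<delta> (Orig v) (Copy b) = 1)"
      using only that by blast
    then show ?thesis using d[OF that(1)] d[OF that(2)] dist_Copy_Copy[OF that] False by auto
  qed
  have OCO: "0 < M.\<delta> (Orig v) (Copy a)" if "a \<in> pverts G" for a
    using d[OF that] by linarith
  have "M.\<delta> x z \<noteq> M.\<delta> x y + M.\<delta> y z" if h: "x \<in> ?S" "y \<in> ?S" "z \<in> ?S" "x \<noteq> y" "y \<noteq> z" for x y z
  proof (cases "Orig v \<in> {x, y, z}")
    case False
    then obtain a b c where "x = Copy a" "y = Copy b" "z = Copy c"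
      "a \<in> pverts G" "b \<in> pverts G" "c \<in> pverts G" using h unfolding S by blast
    then show ?thesis using h by auto
  next
    case True
    consider "y = Orig v" | "x = Orig v" "z = Orig v" "y \<noteq> Orig v" | "x = Orig v" "y \<noteq> Orig v" "z \<noteq> Orig v"
      | "z = Orig v" "y \<noteq> Orig v" "x \<noteq> Orig v" using True by blast
    then show ?thesis
    proof cases
      case 1
      then obtain a c where "x = Copy a" "z = Copy c" "a \<in> pverts G" "c \<in> pverts G"
        using h unfolding S by blast
      then show ?thesis using COC[of a c] 1 M.dist_commute[of x y] by simp
    next
      case 2
      then obtain b where "y = Copy b" "b \<in> pverts G" using h unfolding S by blast
      then have "M.\<delta> x y > 0" using OCO[of b] 2(1) by blast
      moreover have "M.\<delta> x z = 0" using 2 by simp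
      ultimately show ?thesis by linarith
    next
      case 3
      then obtain b c where "y = Copy b" "z = Copy c" "b \<in> pverts G" "c \<in> pverts G"
        using h unfolding S by blast
      then show ?thesis using OCC[of b c] 3 h by blast
    next
      case 4
      then obtain b a where "y = Copy b" "x = Copy a" "b \<in> pverts G" "a \<in> pverts G"
        using h unfolding S by blast
      then have "M.\<delta> z x \<noteq> M.\<delta> z y + M.\<delta> y x" using OCC[of b a] 4(1) h(4) by blast
      then show ?thesis
        unfolding M.dist_commute[of x z] M.dist_commute[of x y] M.dist_commute[of y z] by linarith
    qed
  qed
  moreover have "?S \<subseteq> pverts (mycielskian G)" using assms(1) by (auto simp: S)
  ultimately show ?thesis unfolding M.general_position_set_iff by blast
qed

text \<open>Along a shortest path from \<open>u\<close> to \<open>w\<close> the first three vertices are collinear, in the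
  Mycielskian as well as in \<open>G\<close>.\<close>
lemma not_all_Orig:
  assumes "general_position_set (mycielskian G) S"
    and "u \<in> pverts G" "w \<in> pverts G" "u \<noteq> w" "(u, w) \<notin> parcs G"
  shows "\<not> Orig ` pverts G \<subseteq> S"
proof
  assume all: "Orig ` pverts G \<subseteq> S"
  have "\<delta> u w \<noteq> 0" "\<delta> u w \<noteq> 1"
    using assms(2-5) dist_eq_1_iff[of u w] by auto
  then obtain k where k: "\<delta> u w = Suc (Suc k)"
    by (metis One_nat_def not0_implies_Suc)
  have "(u, w) \<in> parcs G ^^ Suc (Suc k)" using dist_attained[OF assms(2,3)] k by simp
  then obtain c where c: "(u, c) \<in> parcs G" "(c, w) \<in> parcs G ^^ Suc k"
    by (meson relpow_Suc_D2)
  then obtain z where z: "(c, z) \<in> parcs G" "(z, w) \<in> parcs G ^^ k"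
    by (meson relpow_Suc_D2)
  have v: "c \<in> pverts G" "z \<in> pverts G" using c z in_arcsD2 by blast+
  have d: "\<delta> u c = 1" "\<delta> c z = 1" using c z v assms(2) dist_eq_1_iff by blast+
  have "\<delta> u z \<le> 2" using dist_triangle[OF assms(2) v] d by simp
  moreover have "\<delta> u w \<le> \<delta> u z + k"
    using dist_triangle[OF assms(2) v(2) assms(3)] dist_le[OF z(2)] by linarith
  ultimately have "\<delta> u z = 2" using k by linarith
  moreover have "u \<noteq> c" "c \<noteq> z" using d by auto
  moreover have "Orig u \<in> S" "Orig c \<in> S" "Orig z \<in> S" using all v assms(2) by auto
  then have "u \<noteq> c \<Longrightarrow> c \<noteq> z \<Longrightarrow> M.\<delta> (Orig u) (Orig z) \<noteq> M.\<delta> (Orig u) (Orig c) + M.\<delta> (Orig c) (Orig z)"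
    using assms(1) unfolding M.general_position_set_iff by blast
  ultimately show False using d v assms(2) by simp
qed

text \<open>If \<open>S\<close> contains the root, it contains at most one copy, because two copies have the root between
  them. The originals in \<open>S\<close> are not all vertices, so \<open>S\<close> is no larger than the set of all copies
  unless it contains a copy \<open>v'\<close> and all but one of the originals. In that case the neighbours of \<open>v\<close> are
  not in \<open>S\<close>, because \<open>v'\<close> would be between them and the root. So \<open>v\<close> is a leaf, attached to the one
  missing vertex \<open>x\<close>; and the root is not between \<open>v'\<close> and any other original only if the remaining
  vertices are at distance 2 from \<open>v\<close>. Then \<open>v\<close> together with all copies is a set of the same size.\<close>
lemma root_free_alternative:
  assumes gp: "general_position_set (mycielskian G) S" and root: "Root \<in> S"
    and nonadj: "u \<in> pverts G" "w \<in> pverts G" "u \<noteq> w" "(u, w) \<notin> parcs G"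
  shows "\<exists>V1. V1 \<subseteq> pverts G \<and> general_position_set (mycielskian G) (myc_set V1 (pverts G - V1) {}) \<and>
    card S \<le> card (myc_set V1 (pverts G - V1) {})"
proof -
  have free: "M.\<delta> x z \<noteq> M.\<delta> x y + M.\<delta> y z"
    if "x \<in> S" "y \<in> S" "z \<in> S" "x \<noteq> y" "y \<noteq> z" for x y z
    using gp that unfolding M.general_position_set_iff by blast
  have SM: "S \<subseteq> pverts (mycielskian G)" using gp unfolding M.general_position_set_iff by blast
  define A where "A = {u. Orig u \<in> S}"
  have A: "A \<subseteq> pverts G" using SM by (auto simp: A_def)
  then have "A \<subset> pverts G"
    using not_all_Orig[OF gp nonadj] by (auto simp: A_def)
  then have cA: "card A < card (pverts G)" using pair_finite_verts by (rule psubset_card_mono[rotated])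
  have finA: "finite A" using A pair_finite_verts by (rule finite_subset)
  have value0: "card (myc_set {} (pverts G) {}) = card (pverts G)"
    using pair_finite_verts by (simp add: card_myc_set)
  have fallback: ?thesis if "card S \<le> card (pverts G)"
    using that copies_general_position value0 by (intro exI[of _ "{}"]) simp
  show ?thesis
  proof (cases "\<exists>v. Copy v \<in> S")
    case False
    have "S \<subseteq> insert Root (Orig ` A)"
    proof
      fix x assume "x \<in> S"
      then show "x \<in> insert Root (Orig ` A)" using False by (cases x) (auto simp: A_def)
    qed
    then have "card S \<le> card (insert Root (Orig ` A))" by (rule card_mono[rotated]) (simp add: finA)
    also have "\<dots> \<le> Suc (card A)" using card_image_le[OF finA, of Orig] by (simp add: card_insert_if finA)
    finally show ?thesis using cA by (intro fallback) linarith
  next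
    case True
    then obtain v where v: "Copy v \<in> S" by blast
    then have vV: "v \<in> pverts G" using SM by auto
    have only: "c = v" if "Copy c \<in> S" for c
    proof (rule ccontr)
      assume "c \<noteq> v"
      moreover have "c \<in> pverts G" using that SM by auto
      ultimately show False using free[of "Copy c" Root "Copy v"] that v root vV by simp
    qed
    have "S \<subseteq> insert Root (insert (Copy v) (Orig ` A))"
    proof
      fix x assume "x \<in> S"
      then show "x \<in> insert Root (insert (Copy v) (Orig ` A))" using only by (cases x) (auto simp: A_def)
    qed
    then have "card S \<le> card (insert Root (insert (Copy v) (Orig ` A)))"
      by (rule card_mono[rotated]) (simp add: finA)
    also have "\<dots> \<le> Suc (Suc (card A))" using card_image_le[OF finA, of Orig] by (simp add: card_insert_if finA)
    finally have cS: "card S \<le> Suc (Suc (card A))" .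
    have nA: "y \<notin> A" if "(v, y) \<in> parcs G" for y
    proof
      assume "y \<in> A"
      have yV: "y \<in> pverts G" using that in_arcsD2 by blast
      have "\<delta> y v = 1" using that arcs_commute dist_eq_1_iff yV vV by blast
      then have "y \<noteq> v" by auto
      then show False using free[of "Orig y" "Copy v" Root] \<open>y \<in> A\<close> \<open>\<delta> y v = 1\<close> v root vV yV
        by (simp add: A_def)
    qed
    obtain x where x: "(v, x) \<in> parcs G" using ex_neighbour[OF vV] by blast
    then have xV: "x \<in> pverts G" using in_arcsD2 by blast
    show ?thesis
    proof (cases "A = pverts G - {x}")
      case False
      then have "A \<subset> pverts G - {x}" using A nA[OF x] by blast
      then have "card A < card (pverts G - {x})" using pair_finite_verts by (intro psubset_card_mono) auto
      then have "Suc (Suc (card A)) \<le> card (pverts G)" using xV pair_finite_verts by (simp add: card_Diff_singleton)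
      then show ?thesis using cS by (intro fallback) linarith
    next
      case True
      have leaf: "y = x" if "(v, y) \<in> parcs G" for y
        using nA[OF that] True that in_arcsD2 by blast
      have near: "\<delta> v y \<le> 2" if yV: "y \<in> pverts G" for y
      proof -
        consider "y = v" | "y = x" | "y \<noteq> v" "y \<in> A" using True yV by blast
        then show ?thesis
        proof cases
          case 2
          then show ?thesis using x xV vV dist_eq_1_iff[of v x] by simp
        next
          case 3
          then show ?thesis
            using free[of "Orig y" Root "Copy v"] v root vV yV
            by (auto simp: A_def dist_commute[of v y])
        qed simp
      qed
      have "card (myc_set {v} (pverts G - {v}) {}) = Suc (card (pverts G))"
        using pair_finite_verts vV card_gt_0_iff[of "pverts G"]
        by (subst card_myc_set) (auto simp: card_Diff_singleton)
      then have "card S \<le> card (myc_set {v} (pverts G - {v}) {})" using cS cA by linarith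
      moreover have "general_position_set (mycielskian G) (myc_set {v} (pverts G - {v}) {})"
        using vV leaf near by (rule leaf_general_position)
      ultimately show ?thesis using vV by (intro exI[of _ "{v}"]) simp
    qed
  qed
qed

text \<open>A root-free set is encoded by the partition that it induces.\<close>
lemma mgp_bounds_general_position:
  assumes gp: "general_position_set (mycielskian G) S"
    and nonadj: "u \<in> pverts G" "w \<in> pverts G" "u \<noteq> w" "(u, w) \<notin> parcs G"
  shows "\<exists>V1 V2 V3 V4. mgp_partition G V1 V2 V3 V4 \<and> card S \<le> card (myc_set V1 V2 V3)"
proof (cases "Root \<in> S")
  case True
  then obtain V1 where "V1 \<subseteq> pverts G"
    "general_position_set (mycielskian G) (myc_set V1 (pverts G - V1) {})"
    "card S \<le> card (myc_set V1 (pverts G - V1) {})"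
    using root_free_alternative[OF gp _ nonadj] by blast
  then show ?thesis
    using mgp_of_general_position[of V1 "pverts G - V1" "{}" "{}"] by blast
next
  case False
  define V1 where "V1 = {u. Orig u \<in> S \<and> Copy u \<in> S}"
  define V2 where "V2 = {u. Orig u \<notin> S \<and> Copy u \<in> S}"
  define V3 where "V3 = {u. Orig u \<in> S \<and> Copy u \<notin> S}"
  define V4 where "V4 = pverts G - (V1 \<union> V2 \<union> V3)"
  have "x \<in> S \<longleftrightarrow> x \<in> myc_set V1 V2 V3" for x
    using False by (cases x) (auto simp: V1_def V2_def V3_def)
  then have S: "S = myc_set V1 V2 V3" by blast
  have "S \<subseteq> pverts (mycielskian G)" using gp unfolding M.general_position_set_iff by blast
  then have "V1 \<union> V2 \<union> V3 \<subseteq> pverts G" by (auto simp: V1_def V2_def V3_def)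
  then have "mgp_partition G V1 V2 V3 V4"
    using gp unfolding S by (intro mgp_of_general_position) (auto simp: V1_def V2_def V3_def V4_def)
  then show ?thesis using S by blast
qed

end

section \<open>The general position number of the Mycielskian\<close>

theorem corollary9:
  fixes G :: "'a pair_pre_digraph" and n :: nat
  assumes "pair_graph G"
    and "Digraph_Component.connected (with_proj G)"
    and "n = card (pverts G)"
    and "\<not> complete_digraph n (with_proj G)"
  shows "int (gp_number (with_proj (mycielskian G))) =
    Max {int n + int (card V1) - int (card V4) | V1 V2 V3 V4. mgp_partition G V1 V2 V3 V4}"
proof -
  interpret pair_graph G by (rule assms(1))
  have "parcs G \<noteq> {(u, v). (u, v) \<in> pverts G \<times> pverts G \<and> u \<noteq> v}"
    using assms(3,4) pair_finite_verts unfolding complete_digraph_pair_def by blast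
  moreover have "parcs G \<subseteq> {(u, v). (u, v) \<in> pverts G \<times> pverts G \<and> u \<noteq> v}"
    using in_arcsD1 in_arcsD2 by (auto dest: pair_no_loops)
  ultimately obtain u w where uw: "u \<in> pverts G" "w \<in> pverts G" "u \<noteq> w" "(u, w) \<notin> parcs G"
    by blast
  have "strongly_connected (with_proj G)"
    using pair_sym_arcs assms(2) by (rule symmetric_connected_imp_strongly_connected)
  then have "x \<rightarrow>\<^sup>*\<^bsub>with_proj G\<^esub> y" if "x \<in> pverts G" "y \<in> pverts G" for x y
    using that by (simp add: strongly_connected_def)
  then have "(x, y) \<in> (parcs G)\<^sup>*" if "x \<in> pverts G" "y \<in> pverts G" for x y
    using that reachable_rtranclI[of "with_proj G" x y] by simp
  then interpret nontrivial_connected_graph G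
    using uw by unfold_locales auto
  let ?A = "{card S | S. general_position_set (with_proj (mycielskian G)) S}"
  let ?B = "{int n + int (card V1) - int (card V4) | V1 V2 V3 V4. mgp_partition G V1 V2 V3 V4}"
  have "finite {S. general_position_set (with_proj (mycielskian G)) S}"
    by (rule finite_subset[of _ "Pow (pverts (mycielskian G))"])
      (auto simp: general_position_set_def M.pair_finite_verts)
  then have finA: "finite ?A" by simp
  have BA: "?B \<subseteq> int ` ?A"
  proof
    fix b assume "b \<in> ?B"
    then obtain V1 V2 V3 V4 where mgp: "mgp_partition G V1 V2 V3 V4"
      and b: "b = int n + int (card V1) - int (card V4)" by blast
    have "b = int (card (myc_set V1 V2 V3))" using b mgp_value[OF mgp] assms(3) by simp
    moreover have "card (myc_set V1 V2 V3) \<in> ?A" using general_position_of_mgp[OF mgp] by blast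
    ultimately show "b \<in> int ` ?A" by (rule image_eqI)
  qed
  then have finB: "finite ?B" by (rule finite_subset) (simp add: finA)
  have AB: "\<exists>b\<in>?B. int a \<le> b" if aA: "a \<in> ?A" for a
  proof -
    obtain S where "a = card S" "general_position_set (with_proj (mycielskian G)) S"
      using aA by blast
    then obtain V1 V2 V3 V4 where mgp: "mgp_partition G V1 V2 V3 V4"
      and a: "a \<le> card (myc_set V1 V2 V3)"
      using mgp_bounds_general_position[OF _ uw] by blast
    have "int a \<le> int n + int (card V1) - int (card V4)"
      using a mgp_value[OF mgp] assms(3) by simp
    moreover have "int n + int (card V1) - int (card V4) \<in> ?B" using mgp by blast
    ultimately show ?thesis by (rule bexI)
  qed
  have inA: "card (myc_set {} (pverts G) {}) \<in> ?A" using copies_general_position by blast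
  then have neA: "?A \<noteq> {}" by (metis empty_iff)
  have neB: "?B \<noteq> {}" using AB[OF inA] by (metis bex_empty)
  have "int (Max ?A) \<le> Max ?B"
  proof -
    obtain b where "b \<in> ?B" "int (Max ?A) \<le> b" using AB[OF Max_in[OF finA neA]] by (rule bexE)
    then show ?thesis using Max_ge[OF finB, of b] by linarith
  qed
  moreover have "Max ?B \<le> int (Max ?A)"
  proof -
    have "Max ?B \<in> int ` ?A" using BA Max_in[OF finB neB] by (rule subsetD)
    then obtain a where "Max ?B = int a" "a \<in> ?A" by (rule imageE)
    then show ?thesis using Max_ge[OF finA, of a] by linarith
  qed
  ultimately show ?thesis unfolding gp_number_def by linarith
qed

end
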